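(* Let $m\ge1$. Any evaluation scheme is equivalent to a constant-free evaluation scheme: for every triplet $(A,B,c)$ over $\mathbb{C}$ there is a triplet $(\hat A,\hat B,\hat c)$ with $\hat a_{1,1}=\cdots=\hat a_{m,1}=\hat b_{1,1}=\cdots=\hat b_{m,1}=0$ whose associated polynomial equals the polynomial associated with $(A,B,c)$.
   Context: Evaluation scheme. A triplet $(A,B,c)$ (for $m$ multiplications) consists of scalars $a_{i,j},b_{i,j}\in\mathbb{C}$ for $1\le i\le m$, $1\le j\le i+1$ (the entries of $m\times(m+1)$ lower Hessenberg matrices $A,B$; entries with $j>i+1$ are zero), and a vector $c=(c_1,\dots,c_{m+2})\in\mathbb{C}^{m+2}$. The associated polynomial is $p=\sum_{j=1}^{m+2}c_jQ_j\in\mathbb{C}[x]$, where $Q_1=1$, $Q_2=x$, and for $i=1,\dots,m$ $$Q_{i+2}=\Big(\sum_{j=1}^{i+1}a_{i,j}Q_j\Big)\Big(\sum_{j=1}^{i+1}b_{i,j}Q_j\Big).$$ Two evaluation schemes (triplets with the same $m$) are equivalent if they have the same associated polynomial. A scheme is constant-free if $a_{i,1}=b_{i,1}=0$ for all $i=1,\dots,m$. *)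

theory Defs
  imports Complex_Main "HOL-Computational_Algebra.Polynomial" "Jordan_Normal_Form.Matrix"
begin

text \<open>
  Matrices and vectors are indexed from 0 in the library, so the entry written
  $a_{i,j}$ with 1-based indices is \<open>A $$ (i - 1, j - 1)\<close>, likewise for \<open>B\<close>, and $c_j$ is
  \<open>c $ (j - 1)\<close>. The polynomial $Q_j$ is \<open>scheme_Q A B (j - 1)\<close>.
\<close>

type_synonym triplet = "complex mat \<times> complex mat \<times> complex vec"

definition lower_hessenberg :: "complex mat \<Rightarrow> bool" where
  "lower_hessenberg A \<longleftrightarrow> (\<forall>i < dim_row A. \<forall>j < dim_col A. i + 1 < j \<longrightarrow> A $$ (i, j) = 0)"

fun evaluation_scheme :: "nat \<Rightarrow> triplet \<Rightarrow> bool" where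
  "evaluation_scheme m (A, B, c) \<longleftrightarrow>
     A \<in> carrier_mat m (m + 1) \<and> lower_hessenberg A \<and>
     B \<in> carrier_mat m (m + 1) \<and> lower_hessenberg B \<and>
     c \<in> carrier_vec (m + 2)"

text \<open>
  For a scheme with \<open>m\<close> multiplications only the values of \<open>scheme_Q A B\<close> at indices below
  \<open>m + 2\<close> are meaningful; beyond that the recursion reads entries outside the matrices.
\<close>

fun scheme_Q :: "complex mat \<Rightarrow> complex mat \<Rightarrow> nat \<Rightarrow> complex poly" where
  "scheme_Q A B 0 = 1"
| "scheme_Q A B (Suc 0) = [:0, 1:]"
| "scheme_Q A B (Suc (Suc i)) =
     (\<Sum>j\<le>i + 1. Polynomial.smult (A $$ (i, j)) (scheme_Q A B j)) *
     (\<Sum>j\<le>i + 1. Polynomial.smult (B $$ (i, j)) (scheme_Q A B j))"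

fun associated_poly :: "nat \<Rightarrow> triplet \<Rightarrow> complex poly" where
  "associated_poly m (A, B, c) = (\<Sum>j<m + 2. Polynomial.smult (c $ j) (scheme_Q A B j))"

definition equivalent_schemes :: "nat \<Rightarrow> triplet \<Rightarrow> triplet \<Rightarrow> bool" where
  "equivalent_schemes m S T \<longleftrightarrow>
     evaluation_scheme m S \<and> evaluation_scheme m T \<and> associated_poly m S = associated_poly m T"

fun constant_free :: "nat \<Rightarrow> triplet \<Rightarrow> bool" where
  "constant_free m (A, B, c) \<longleftrightarrow> (\<forall>i<m. A $$ (i, 0) = 0 \<and> B $$ (i, 0) = 0)"

end

theory Submission
  imports Defs
begin

text \<open>
  Removing the constant terms from the two factors of every \<open>Q\<^sub>i\<close> yields a sequence of
  polynomials that is again produced by a scheme: if \<open>L\<close>, \<open>R\<close> are the factors, with constant terms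
  \<open>\<alpha>\<close>, \<open>\<beta>\<close>, then \<open>L R - \<alpha> \<beta> = (L - \<alpha>) (R - \<beta>) + \<alpha> (R - \<beta>) + \<beta> (L - \<alpha>)\<close>. So, inductively, each
  \<open>Q\<^sub>i\<close> without its constant term is a linear combination of \<open>x\<close> and the new polynomials up to
  index \<open>i\<close>, and hence so are the factors of the next one.
\<close>

definition drop_const :: "'a::comm_ring_1 poly \<Rightarrow> 'a poly" where
  "drop_const p = p - [:coeff p 0:]"

lemma drop_const_1 [simp]: "drop_const 1 = 0"
  by (simp add: drop_const_def one_pCons)

lemma drop_const_X [simp]: "drop_const [:0, 1:] = [:0, 1:]"
  by (simp add: drop_const_def)

lemma drop_const_add: "drop_const (p + q) = drop_const p + drop_const q"
  by (simp add: drop_const_def algebra_simps)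

lemma drop_const_smult: "drop_const (Polynomial.smult a p) = Polynomial.smult a (drop_const p)"
  by (simp add: drop_const_def smult_diff_right)

lemma drop_const_sum: "drop_const (\<Sum>i\<in>I. f i) = (\<Sum>i\<in>I. drop_const (f i))"
  by (induction I rule: infinite_finite_induct)
    (simp_all add: drop_const_add, simp_all add: drop_const_def)

lemma drop_const_mult:
  "drop_const (p * q) = drop_const p * drop_const q
     + Polynomial.smult (coeff p 0) (drop_const q) + Polynomial.smult (coeff q 0) (drop_const p)"
  by (simp add: drop_const_def algebra_simps coeff_mult_0 smult_diff_right)

text \<open>Summation starts at 1 because index 0 will carry the constant polynomial 1, which a
  constant-free scheme may not use in its factors.\<close>

definition lin_comb :: "(nat \<Rightarrow> 'a::comm_ring_1 poly) \<Rightarrow> nat \<Rightarrow> 'a poly \<Rightarrow> bool" where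
  "lin_comb f k p \<longleftrightarrow> (\<exists>t. p = (\<Sum>j=1..k. Polynomial.smult (t j) (f j)))"

lemma lin_comb_0: "lin_comb f k 0"
  unfolding lin_comb_def by (intro exI[of _ "\<lambda>_. 0"]) simp

lemma lin_comb_add:
  assumes "lin_comb f k p" "lin_comb f k q"
  shows "lin_comb f k (p + q)"
proof -
  obtain s t where "p = (\<Sum>j=1..k. Polynomial.smult (s j) (f j))"
    and "q = (\<Sum>j=1..k. Polynomial.smult (t j) (f j))"
    using assms unfolding lin_comb_def by blast
  then have "p + q = (\<Sum>j=1..k. Polynomial.smult (s j + t j) (f j))"
    by (simp add: sum.distrib smult_add_left)
  then show ?thesis
    unfolding lin_comb_def by (intro exI)
qed

lemma lin_comb_smult:
  assumes "lin_comb f k p"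
  shows "lin_comb f k (Polynomial.smult a p)"
proof -
  obtain t where "p = (\<Sum>j=1..k. Polynomial.smult (t j) (f j))"
    using assms unfolding lin_comb_def by blast
  then have "Polynomial.smult a p = (\<Sum>j=1..k. Polynomial.smult (a * t j) (f j))"
    by (intro poly_eqI) (simp add: coeff_sum sum_distrib_left mult.assoc)
  then show ?thesis
    unfolding lin_comb_def by (intro exI)
qed

lemma lin_comb_sum: "(\<And>i. i \<in> I \<Longrightarrow> lin_comb f k (g i)) \<Longrightarrow> lin_comb f k (\<Sum>i\<in>I. g i)"
  by (induction I rule: infinite_finite_induct) (auto intro: lin_comb_0 lin_comb_add)

lemma lin_comb_base:
  assumes "1 \<le> j" "j \<le> k"
  shows "lin_comb f k (f j)"
  unfolding lin_comb_def
proof (intro exI)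
  show "f j = (\<Sum>i=1..k. Polynomial.smult (if i = j then 1 else 0) (f i))"
    using assms by (simp add: if_distrib[of "\<lambda>a. Polynomial.smult a _"] cong: if_cong)
qed

lemma lin_comb_mono:
  assumes "lin_comb f k p" "k \<le> l"
  shows "lin_comb f l p"
proof -
  obtain t where "p = (\<Sum>j=1..k. Polynomial.smult (t j) (f j))"
    using assms unfolding lin_comb_def by blast
  then show ?thesis
    using assms(2) by (auto intro!: lin_comb_sum lin_comb_smult lin_comb_base)
qed

definition factor :: "complex mat \<Rightarrow> (nat \<Rightarrow> complex poly) \<Rightarrow> nat \<Rightarrow> complex poly" where
  "factor M f i = (\<Sum>j\<le>i + 1. Polynomial.smult (M $$ (i, j)) (f j))"

text \<open>The factors come from the original scheme, so this sequence does not refer to itself;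
  that some scheme produces it is shown only in the final theorem.\<close>

fun reduced_Q :: "complex mat \<Rightarrow> complex mat \<Rightarrow> nat \<Rightarrow> complex poly" where
  "reduced_Q A B 0 = 1"
| "reduced_Q A B (Suc 0) = [:0, 1:]"
| "reduced_Q A B (Suc (Suc i)) =
     drop_const (factor A (scheme_Q A B) i) * drop_const (factor B (scheme_Q A B) i)"

text \<open>\<open>J\<close> is left general to serve both the factors and the final output
  polynomial.\<close>

lemma lin_comb_drop_const_sum:
  assumes "\<And>j. j \<in> J \<Longrightarrow> j \<le> k"
    and "\<And>j. j \<in> J \<Longrightarrow> lin_comb f j (drop_const (scheme_Q A B j))"
  shows "lin_comb f k (drop_const (\<Sum>j\<in>J. Polynomial.smult (a j) (scheme_Q A B j)))"
  unfolding drop_const_sum drop_const_smult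
  using assms by (auto intro!: lin_comb_sum lin_comb_smult intro: lin_comb_mono)

text \<open>In \<open>drop_const_mult\<close> the product term is \<open>reduced_Q A B k\<close>
  itself, and the other two terms are multiples of reduced factors, covered by the induction
  hypothesis.\<close>

lemma lin_comb_drop_const_scheme_Q: "lin_comb (reduced_Q A B) k (drop_const (scheme_Q A B k))"
proof (induction k rule: less_induct)
  case (less k)
  consider "k = 0" | "k = Suc 0" | i where "k = Suc (Suc i)"
    by (metis nat.exhaust)
  then show ?case
  proof cases
    case 1
    then show ?thesis by (simp add: lin_comb_0)
  next
    case 2
    then show ?thesis
      using lin_comb_base[of 1 1 "reduced_Q A B"] by simp
  next
    case (3 i)
    \<comment> \<open>A factor only involves indices up to \<open>i + 1\<close>, which is below
      \<open>k\<close>.\<close>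
    have *: "lin_comb (reduced_Q A B) k (drop_const (factor M (scheme_Q A B) i))" for M
      unfolding factor_def by (intro lin_comb_drop_const_sum less.IH) (auto simp: 3)
    have "scheme_Q A B k = factor A (scheme_Q A B) i * factor B (scheme_Q A B) i"
      by (simp add: 3 factor_def)
    moreover have "lin_comb (reduced_Q A B) k (reduced_Q A B k)"
      by (rule lin_comb_base) (simp_all add: 3)
    ultimately show ?thesis
      using * by (simp add: drop_const_mult 3 lin_comb_add lin_comb_smult)
  qed
qed

text \<open>The lower bound on \<open>j\<close> makes the scheme constant-free, the upper one gives
  the Hessenberg shape.\<close>

definition const_free_mat :: "nat \<Rightarrow> (nat \<Rightarrow> nat \<Rightarrow> complex) \<Rightarrow> complex mat" where
  "const_free_mat m s = mat m (m + 1) (\<lambda>(i, j). if 1 \<le> j \<and> j \<le> i + 1 then s i j else 0)"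

lemma factor_const_free_mat:
  assumes "i < m"
  shows "factor (const_free_mat m s) f i = (\<Sum>j=1..i + 1. Polynomial.smult (s i j) (f j))"
  unfolding factor_def using assms
  by (intro sum.mono_neutral_cong_right) (auto simp: const_free_mat_def)

lemma factor_cong: "(\<And>j. j \<le> i + 1 \<Longrightarrow> f j = g j) \<Longrightarrow> factor M f i = factor M g i"
  by (simp add: factor_def)

theorem corollary3p4:
  fixes m :: nat and A B :: "complex mat" and c :: "complex vec"
  assumes "m \<ge> 1"
    and "evaluation_scheme m (A, B, c)"
  shows "\<exists>A' B' c'. evaluation_scheme m (A', B', c') \<and> constant_free m (A', B', c') \<and>
           equivalent_schemes m (A, B, c) (A', B', c')"
proof -
  define Q where "Q = reduced_Q A B"
  define p where "p = associated_poly m (A, B, c)"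
  \<comment> \<open>The upper limit \<open>i + 1\<close> matters: the coefficients must fit into row
    \<open>i\<close> of a Hessenberg matrix.\<close>
  have "\<exists>s. \<forall>i. drop_const (factor M (scheme_Q A B) i)
          = (\<Sum>j=1..i + 1. Polynomial.smult (s i j) (Q j))" for M
  proof -
    have "lin_comb Q (i + 1) (drop_const (factor M (scheme_Q A B) i))" for i
      unfolding factor_def Q_def by (intro lin_comb_drop_const_sum lin_comb_drop_const_scheme_Q) auto
    then show ?thesis
      unfolding lin_comb_def by metis
  qed
  then obtain s t
    where s: "\<And>i. drop_const (factor A (scheme_Q A B) i)
                = (\<Sum>j=1..i + 1. Polynomial.smult (s i j) (Q j))"
      and t: "\<And>i. drop_const (factor B (scheme_Q A B) i)
                = (\<Sum>j=1..i + 1. Polynomial.smult (t i j) (Q j))"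
    by metis
  have "lin_comb Q (m + 1) (drop_const p)"
    unfolding p_def Q_def associated_poly.simps
    by (intro lin_comb_drop_const_sum lin_comb_drop_const_scheme_Q) auto
  then obtain u where u: "drop_const p = (\<Sum>j=1..m + 1. Polynomial.smult (u j) (Q j))"
    unfolding lin_comb_def by blast
  define A' where "A' = const_free_mat m s"
  define B' where "B' = const_free_mat m t"
  \<comment> \<open>Constant-freeness does not restrict the output vector, so its entry 0 can
    restore the constant term of \<open>p\<close>.\<close>
  define c' where "c' = vec (m + 2) (\<lambda>j. if j = 0 then coeff p 0 else u j)"
  have Q: "scheme_Q A' B' k = Q k" if "k < m + 2" for k
    using that
  proof (induction k rule: less_induct)
    case (less k)
    consider "k = 0" | "k = Suc 0" | i where "k = Suc (Suc i)"
      by (metis nat.exhaust)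
    then show ?case
    proof cases
      case (3 i)
      then have "i < m" using less.prems by simp
      have *: "factor M (scheme_Q A' B') i = factor M Q i" for M
        using less.IH less.prems by (intro factor_cong) (auto simp: 3)
      have "scheme_Q A' B' k = factor A' (scheme_Q A' B') i * factor B' (scheme_Q A' B') i"
        by (simp add: 3 factor_def)
      also have "\<dots> = factor A' Q i * factor B' Q i"
        by (simp only: *)
      \<comment> \<open>The rows of \<open>A'\<close> and \<open>B'\<close> were chosen as the
        coefficients of the reduced factors over \<open>Q\<close>.\<close>
      also have "\<dots> = drop_const (factor A (scheme_Q A B) i) * drop_const (factor B (scheme_Q A B) i)"
        by (simp only: A'_def B'_def factor_const_free_mat[OF \<open>i < m\<close>] s t)
      also have "\<dots> = Q k"
        by (simp add: 3 Q_def)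
      finally show ?thesis .
    qed (simp_all add: Q_def)
  qed
  have "associated_poly m (A', B', c') = (\<Sum>j<m + 2. Polynomial.smult (c' $ j) (Q j))"
    by (simp add: Q del: sum.lessThan_Suc)
  also have "\<dots> = Polynomial.smult (c' $ 0) (Q 0) + (\<Sum>j=1..m + 1. Polynomial.smult (c' $ j) (Q j))"
  proof -
    have "{..<m + 2} = insert 0 {1..m + 1}" by auto
    then show ?thesis by simp
  qed
  also have "\<dots> = [:coeff p 0:] + drop_const p"
    by (simp add: c'_def u Q_def del: sum.cl_ivl_Suc)
  also have "\<dots> = p"
    by (simp add: drop_const_def)
  finally have "associated_poly m (A, B, c) = associated_poly m (A', B', c')"
    by (simp add: p_def)
  moreover have "evaluation_scheme m (A', B', c')"
    by (auto simp: A'_def B'_def c'_def const_free_mat_def lower_hessenberg_def)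
  moreover have "constant_free m (A', B', c')"
    by (simp add: A'_def B'_def const_free_mat_def)
  ultimately show ?thesis
    using assms(2) unfolding equivalent_schemes_def by blast
qed

end
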